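(* In first-order logic, every contradiction based on standard extension is a standard contradiction. Precisely: let $m\ge2$, let $D_1,\dots,D_m$ be first-order clauses with substitutions $\theta_1,\dots,\theta_m$, let $L_1,\dots,L_{m-1}$ be literals, and suppose sub-clauses $D_i^{\theta_i-}\subseteq D_i^{\theta_i}$ are given with $D_1^{\theta_1-}=\{L_1\}$, $D_i^{\theta_i-}=\{L_i,\neg L_{i-1}\}\cup E^i$ for $2\le i\le m-1$, and $D_m^{\theta_m-}=\{\neg L_{m-1}\}\cup E^m$, where $E^2=\emptyset$ and $E^j\subseteq\{\neg L_1,\dots,\neg L_{j-2}\}$ for $3\le j\le m$. Then for every tuple $(p_1,\dots,p_m)$ with $p_i\in D_i^{\theta_i-}$, there exist $i,j$ such that $p_i$ and $p_j$ are complementary.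
   Context: First-order logic. A literal is an atomic formula or its negation; two literals are complementary if one is $A$ and the other is $\neg A$ for the same (syntactically identical) atom $A$. A clause is a finite disjunction of literals, identified with the set of its literals, its variables implicitly universally quantified. For a substitution $\theta$, $D^{\theta}$ denotes the clause obtained by applying $\theta$ to every literal of $D$ and merging identical literals. A finite list of clauses $E_1,\dots,E_m$ is a standard contradiction if every tuple in $E_1\times\cdots\times E_m$ contains a complementary pair. The conjunction $\bigwedge_{i=1}^m D_i^{\theta_i-}$ as in the claim is called a contradiction based on standard extension of $D_1^{\theta_1},\dots,D_m^{\theta_m}$. *)

theory Defs
  imports Main "HOL-Library.FSet"
begin

text \<open>
  As usual in Isabelle formalizations, arities are not fixed by a signature: a symbol together with
  the length of its argument list plays the role of a symbol of that arity.
\<close>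

datatype ('f, 'v) fo_term = Var 'v | Fun 'f "('f, 'v) fo_term list"

datatype ('p, 'f, 'v) atom = Atom 'p "('f, 'v) fo_term list"

datatype ('p, 'f, 'v) literal = Pos "('p, 'f, 'v) atom" | Neg "('p, 'f, 'v) atom"

type_synonym ('p, 'f, 'v) clause = "('p, 'f, 'v) literal fset"

type_synonym ('f, 'v) subst = "'v \<Rightarrow> ('f, 'v) fo_term"

text \<open>On literals, \<open>\<not>\<not>A\<close> is identified with \<open>A\<close>, so that \<open>\<not>L\<close> is again a literal.\<close>

fun neg :: "('p, 'f, 'v) literal \<Rightarrow> ('p, 'f, 'v) literal" where
  "neg (Pos A) = Neg A"
| "neg (Neg A) = Pos A"

definition complementary :: "('p, 'f, 'v) literal \<Rightarrow> ('p, 'f, 'v) literal \<Rightarrow> bool" where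
  "complementary K K' \<longleftrightarrow> (\<exists>A. K = Pos A \<and> K' = Neg A \<or> K = Neg A \<and> K' = Pos A)"

primrec subst_term :: "('f, 'v) subst \<Rightarrow> ('f, 'v) fo_term \<Rightarrow> ('f, 'v) fo_term" where
  "subst_term \<theta> (Var x) = \<theta> x"
| "subst_term \<theta> (Fun f ts) = Fun f (map (subst_term \<theta>) ts)"

primrec subst_atom :: "('f, 'v) subst \<Rightarrow> ('p, 'f, 'v) atom \<Rightarrow> ('p, 'f, 'v) atom" where
  "subst_atom \<theta> (Atom P ts) = Atom P (map (subst_term \<theta>) ts)"

primrec subst_lit :: "('f, 'v) subst \<Rightarrow> ('p, 'f, 'v) literal \<Rightarrow> ('p, 'f, 'v) literal" where
  "subst_lit \<theta> (Pos A) = Pos (subst_atom \<theta> A)"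
| "subst_lit \<theta> (Neg A) = Neg (subst_atom \<theta> A)"

definition subst_clause :: "('f, 'v) subst \<Rightarrow> ('p, 'f, 'v) clause \<Rightarrow> ('p, 'f, 'v) clause" where
  "subst_clause \<theta> D = subst_lit \<theta> |`| D"

text \<open>A tuple in \<open>E\<^sub>1 \<times> \<dots> \<times> E\<^sub>m\<close> is a list \<open>ps\<close> related to \<open>[E\<^sub>1, \<dots>, E\<^sub>m]\<close> pointwise by membership.\<close>

definition standard_contradiction :: "('p, 'f, 'v) clause list \<Rightarrow> bool" where
  "standard_contradiction Es \<longleftrightarrow>
     (\<forall>ps. list_all2 (\<lambda>p E. p |\<in>| E) ps Es \<longrightarrow>
        (\<exists>i < length ps. \<exists>j < length ps. complementary (ps ! i) (ps ! j)))"

end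

(* In a tuple without a complementary pair, p_i = L_i for every i < m: all other literals available
   at position i are negations of some L_k = p_k with k < i. But at position m only such negations
   are available. *)
theory Submission imports Defs begin

lemma complementary_neg: "complementary K (neg K)"
  by (cases K) (auto simp: complementary_def)

theorem theorem5p1:
  fixes m :: nat
    and D :: "nat \<Rightarrow> ('p, 'f, 'v) clause"
    and \<theta> :: "nat \<Rightarrow> ('f, 'v) subst"
    and L :: "nat \<Rightarrow> ('p, 'f, 'v) literal"
    and Dm :: "nat \<Rightarrow> ('p, 'f, 'v) clause"
    and E :: "nat \<Rightarrow> ('p, 'f, 'v) clause"
  assumes "m \<ge> 2"
    and "\<And>i. i \<in> {1..m} \<Longrightarrow> Dm i |\<subseteq>| subst_clause (\<theta> i) (D i)"
    and "Dm 1 = {|L 1|}"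
    and "\<And>i. i \<in> {2..m - 1} \<Longrightarrow> Dm i = {|L i, neg (L (i - 1))|} |\<union>| E i"
    and "Dm m = {|neg (L (m - 1))|} |\<union>| E m"
    and "E 2 = {||}"
    and "\<And>j. j \<in> {3..m} \<Longrightarrow> fset (E j) \<subseteq> {neg (L k) | k. k \<in> {1..j - 2}}"
  shows "standard_contradiction (map Dm [1..<Suc m])"
proof -
  \<comment> \<open>The range \<open>k < j\<close>, wider than \<open>k \<le> j - 2\<close>, also
    holds the index \<open>j - 1\<close> of the explicit literal \<open>neg (L (j - 1))\<close> and
    absorbs the empty \<open>E 2\<close>, so \<open>j = 2\<close> is not special below.\<close>
  have earlier: "E j |\<subseteq>| (\<lambda>k. neg (L k)) |`| fset_of_list [1..<j]" if "j \<in> {2..m}" for j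
  proof (cases "j = 2")
    case True
    with assms(6) show ?thesis by simp
  next
    case False
    with that have "j \<in> {3..m}" by auto
    from assms(7)[OF this] show ?thesis
      by (force simp: less_eq_fset.rep_eq fset_of_list.rep_eq)
  qed
  \<comment> \<open>For \<open>i = 1\<close> the range \<open>{1..<i}\<close> is empty, in keeping
    with the unit clause \<open>Dm 1\<close>; the induction below then needs no base case.\<close>
  have inner: "p = L i \<or> (\<exists>k\<in>{1..<i}. p = neg (L k))" if "i \<in> {1..<m}" "p |\<in>| Dm i" for i p
  proof (cases "i = 1")
    case True
    with that(2) assms(3) show ?thesis by simp
  next
    case False
    with that(1) have i: "i \<in> {2..m - 1}" "i \<in> {2..m}" by auto
    from that(2) assms(4)[OF i(1)] earlier[OF i(2)] i(1) show ?thesis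
      by (fastforce simp: less_eq_fset.rep_eq fset_of_list.rep_eq)
  qed
  \<comment> \<open>Since \<open>m \<ge> 2\<close>, the index \<open>m - 1\<close> lies in the range
    and \<open>earlier\<close> applies to \<open>m\<close>.\<close>
  have last: "\<exists>k\<in>{1..<m}. p = neg (L k)" if "p |\<in>| Dm m" for p
    using that assms(1,5) earlier[of m]
    by (fastforce simp: less_eq_fset.rep_eq fset_of_list.rep_eq)
  show ?thesis
    unfolding standard_contradiction_def
  proof (intro allI impI, rule ccontr)
    fix ps
    assume "list_all2 (\<lambda>p E. p |\<in>| E) ps (map Dm [1..<Suc m])"
      and none: "\<not> (\<exists>i<length ps. \<exists>j<length ps. complementary (ps ! i) (ps ! j))"
    \<comment> \<open>Without \<open>upt_Suc\<close> the list \<open>[1..<Suc m]\<close> stays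
      whole, and its entry at \<open>i\<close> simplifies to \<open>Suc i\<close>.\<close>
    then have len: "length ps = m" and mem: "\<forall>i<m. ps ! i |\<in>| Dm (Suc i)"
      by (auto simp: list_all2_conv_all_nth simp del: upt_Suc)
    \<comment> \<open>Shifts the list positions, counted from 0, to the clause indices, counted from
      1.\<close>
    define p where "p i = ps ! (i - 1)" for i
    have p: "p i |\<in>| Dm i" if "i \<in> {1..m}" for i
      using that mem[rule_format, of "i - 1"] by (auto simp: p_def)
    have no_compl: "\<not> complementary (p i) (p j)" if "i \<in> {1..m}" "j \<in> {1..m}" for i j
      using that none len by (auto simp: p_def)
    have p_eq: "p i = L i" if "i \<in> {1..<m}" for i
      using that
    proof (induction i rule: less_induct)
      case (less i)
      \<comment> \<open>Otherwise \<open>p k = L k\<close>, the induction hypothesis, would be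
        complementary to \<open>p i\<close>. Only the first alternative of \<open>inner\<close> is
        left.\<close>
      have "p i \<noteq> neg (L k)" if "k \<in> {1..<i}" for k
        using that less.prems less.IH[of k] no_compl[of k i] complementary_neg[of "L k"] by auto
      with inner[OF less.prems, of "p i"] p[of i] less.prems show ?case by auto
    qed
    obtain k where "k \<in> {1..<m}" "p m = neg (L k)"
      using last[of "p m"] p[of m] assms(1) by auto
    with p_eq[of k] no_compl[of k m] complementary_neg[of "L k"] show False by auto
  qed
qed

end
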